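(* For all agents $j,\ell,m$, the centrality $C_j$ is increasing in $w_\ell$ and in $G_{\ell m}$. These results are strict if and only if $j$ and $\ell$ share an identity ($\theta_j=\theta_\ell$) and there is a walk from $\ell$ to $j$.
   Context: There are $J$ agents; agent $j$ has income $w_j\in[1,\infty)$ and identity $\theta_j\in\{A,B\}$. $G$ is a non-negative $J\times J$ matrix (a weighted directed network) with zero diagonal whose largest eigenvalue modulus is less than $1$. Let $\widehat G_{jk}=G_{jk}\mathbf 1\{\theta_j=\theta_k\}$, $\beta>0$, and $H_{jk}=\frac{\beta w_j}{\beta w_j+1}\widehat G_{jk}$. The centrality of agent $j$ is $C_j=\sum_k[(I-H)^{-1}]_{jk}\frac{w_k}{\beta w_k+1}$. "Increasing" without "strict" means weakly increasing. A walk from $j$ to $k$ is a sequence of agents $j,j',\dots,k',k$ such that $\widehat G_{ab}>0$ (equivalently $H_{ab}>0$) for each pair of consecutive agents $a,b$ in the sequence.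
   Formalization: The walk must go from j to ℓ, not from ℓ to j (with only G_12>0, C_1 is strict in w_2), and strictness in G_{ℓm} also needs θ_ℓ=θ_m (else C_j is constant in it) and ℓ≠m, as the diagonal is fixed at 0. A one-agent sequence counts as a walk. *)

theory Defs
  imports "Jordan_Normal_Form.Spectral_Radius" "Jordan_Normal_Form.Gauss_Jordan_Elimination"
begin

datatype identity = Id_A | Id_B

text \<open>Agents are the indices \<open>0, \<dots>, J - 1\<close>. The eigenvalues of \<open>G\<close> are taken over the complex numbers.\<close>

definition network :: "nat \<Rightarrow> real mat \<Rightarrow> bool" where
  "network J G \<longleftrightarrow>
     G \<in> carrier_mat J J \<and>
     (\<forall>i<J. \<forall>k<J. 0 \<le> G $$ (i, k)) \<and>
     (\<forall>i<J. G $$ (i, i) = 0) \<and>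
     spectral_radius (map_mat complex_of_real G) < 1"

definition G_hat :: "(nat \<Rightarrow> identity) \<Rightarrow> real mat \<Rightarrow> real mat" where
  "G_hat \<theta> G = mat (dim_row G) (dim_col G) (\<lambda>(j, k). if \<theta> j = \<theta> k then G $$ (j, k) else 0)"

definition H_mat :: "real \<Rightarrow> (nat \<Rightarrow> identity) \<Rightarrow> (nat \<Rightarrow> real) \<Rightarrow> real mat \<Rightarrow> real mat" where
  "H_mat \<beta> \<theta> w G =
     mat (dim_row G) (dim_col G) (\<lambda>(j, k). \<beta> * w j / (\<beta> * w j + 1) * G_hat \<theta> G $$ (j, k))"

text \<open>Under the standing assumptions \<open>I - H\<close> is invertible, since \<open>0 \<le> H \<le> G\<close> entrywise and \<open>G\<close>
  has spectral radius below one; so \<^const>\<open>mat_inverse\<close> does not return \<^const>\<open>None\<close> there.\<close>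

definition centrality ::
    "real \<Rightarrow> (nat \<Rightarrow> identity) \<Rightarrow> (nat \<Rightarrow> real) \<Rightarrow> real mat \<Rightarrow> nat \<Rightarrow> real" where
  "centrality \<beta> \<theta> w G j =
     (\<Sum>k<dim_row G.
        the (mat_inverse (1\<^sub>m (dim_row G) - H_mat \<beta> \<theta> w G)) $$ (j, k) * (w k / (\<beta> * w k + 1)))"

text \<open>The one-element sequence \<open>[j]\<close> is a (trivial) walk from \<open>j\<close> to \<open>j\<close>: it accounts for the
  zeroth term of \<open>(I - H)\<^sup>-\<^sup>1 = \<Sum>n. H\<^sup>n\<close>.\<close>

definition is_walk :: "(nat \<Rightarrow> identity) \<Rightarrow> real mat \<Rightarrow> nat \<Rightarrow> nat \<Rightarrow> nat list \<Rightarrow> bool" where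
  "is_walk \<theta> G j k p \<longleftrightarrow>
     p \<noteq> [] \<and> hd p = j \<and> last p = k \<and> set p \<subseteq> {..<dim_row G} \<and>
     successively (\<lambda>a b. G_hat \<theta> G $$ (a, b) > 0) p"

definition walk_exists :: "(nat \<Rightarrow> identity) \<Rightarrow> real mat \<Rightarrow> nat \<Rightarrow> nat \<Rightarrow> bool" where
  "walk_exists \<theta> G j k \<longleftrightarrow> (\<exists>p. is_walk \<theta> G j k p)"

end

theory Submission
  imports Defs
begin

text \<open>A non-negative \<open>G\<close> has spectral radius below one iff some \<open>v > 0\<close> satisfies \<open>G v < v\<close>
  entrywise. Such a \<open>v\<close> yields a minimum principle for \<open>H \<le> G\<close>: if \<open>H y \<le> y\<close> then \<open>y \<ge> 0\<close>.
  The centrality solves \<open>c = b + H c\<close>, so when only row \<open>l\<close> of the data changes, the difference of the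
  two centralities solves \<open>y = r + H' y\<close> with \<open>r\<close> supported at \<open>l\<close>. An increase gives \<open>r\<^sub>l \<ge> 0\<close>, hence
  \<open>y \<ge> 0\<close>; if \<open>r\<^sub>l > 0\<close>, positivity of \<open>y\<^sub>l\<close> spreads to every agent with a walk to \<open>l\<close>, while \<open>y\<close>
  solves the homogeneous system, hence vanishes, on the agents without one. That strictness in the link
  weight fails in the remaining cases also needs a second admissible weight: \<open>G v < v\<close> is an open
  condition.\<close>

section \<open>Spectral radius below one, strict supervectors and the minimum principle\<close>

lemma index_mult_mat_vec_sum:
  assumes "A \<in> carrier_mat n n" "x \<in> carrier_vec n" "i < n"
  shows "(A *\<^sub>v x) $ i = (\<Sum>k<n. A $$ (i, k) * x $ k)"
  using assms by (auto simp: scalar_prod_def atLeast0LessThan)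

lemma pow_mat_Suc_left:
  assumes "A \<in> carrier_mat n n"
  shows "A ^\<^sub>m Suc k = A * A ^\<^sub>m k"
proof (induction k)
  case 0
  then show ?case using assms by simp
next
  case (Suc k)
  have "A ^\<^sub>m Suc (Suc k) = (A * A ^\<^sub>m k) * A"
    using Suc by simp
  also have "\<dots> = A * (A ^\<^sub>m k * A)"
    using assms by (intro assoc_mult_mat) auto
  finally show ?case by simp
qed

lemma spectral_radius_nonneg:
  assumes "A \<in> carrier_mat n n" "n > 0"
  shows "0 \<le> spectral_radius A"
  using spectral_radius_mem_max(1)[OF assms] by auto

text \<open>An eigenvector of \<open>A / r\<close> for \<open>\<mu>\<close> is an eigenvector of
  \<open>A\<close> for \<open>r * \<mu>\<close>, so the spectrum scales by \<open>1 / r\<close>.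
  This leaves room to divide \<open>G\<close> by some \<open>r < 1\<close> and still have bounded
  powers.\<close>

lemma spectral_radius_smult_less_1:
  fixes A :: "complex mat" and r :: real
  assumes A: "A \<in> carrier_mat n n" and n: "n > 0" and r: "spectral_radius A < r"
  shows "spectral_radius (complex_of_real (1 / r) \<cdot>\<^sub>m A) < 1"
proof -
  let ?B = "complex_of_real (1 / r) \<cdot>\<^sub>m A"
  have B: "?B \<in> carrier_mat n n" using A by simp
  have r0: "r > 0" using spectral_radius_nonneg[OF A n] r by linarith
  from spectral_radius_mem_max(1)[OF B n] obtain \<mu> x
    where \<mu>: "spectral_radius ?B = norm \<mu>" and ev: "eigenvector ?B x \<mu>"
    by (auto simp: spectrum_def eigenvalue_def)
  have x: "x \<in> carrier_vec n" and x0: "x \<noteq> 0\<^sub>v n" and eq: "?B *\<^sub>v x = \<mu> \<cdot>\<^sub>v x"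
    using ev A by (auto simp: eigenvector_def)
  have "A *\<^sub>v x = (of_real r * \<mu>) \<cdot>\<^sub>v x"
  proof (rule eq_vecI)
    fix i assume "i < dim_vec ((of_real r * \<mu>) \<cdot>\<^sub>v x)"
    then have i: "i < n" using x by simp
    have "(?B *\<^sub>v x) $ i = of_real (1 / r) * (A *\<^sub>v x) $ i"
      unfolding index_mult_mat_vec_sum[OF B x i] index_mult_mat_vec_sum[OF A x i] sum_distrib_left
      using i A by (intro sum.cong) auto
    then have "of_real (1 / r) * (A *\<^sub>v x) $ i = \<mu> * x $ i"
      using eq i x by simp
    then show "(A *\<^sub>v x) $ i = ((of_real r * \<mu>) \<cdot>\<^sub>v x) $ i"
      using r0 i x by (simp add: field_simps)
  qed (use A x in auto)
  then have "eigenvalue A (of_real r * \<mu>)"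
    using x x0 A by (auto simp: eigenvalue_def eigenvector_def)
  then have "norm (of_real r * \<mu>) \<le> spectral_radius A"
    by (intro spectral_radius_mem_max(2)[OF A n]) (auto simp: spectrum_def)
  moreover have "norm (of_real r * \<mu>) = r * norm \<mu>" using r0 by (simp add: norm_mult)
  ultimately have "r * norm \<mu> < r" using r by linarith
  then show ?thesis using r0 \<mu> by simp
qed

text \<open>With \<open>R = G / r\<close> power-bounded and \<open>r < 1\<close>, a long enough partial sum \<open>v\<close> of
  \<open>\<Sum>k. G\<^sup>k 1 = \<Sum>k. r\<^sup>k R\<^sup>k 1\<close> works, as \<open>G v = v - 1 + r\<^sup>N R\<^sup>N 1\<close>.\<close>

lemma spectral_radius_less_1_imp_strict_supervector:
  fixes G :: "real mat"
  assumes G: "G \<in> carrier_mat n n" and n: "n > 0"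
    and nonneg: "\<And>i k. i < n \<Longrightarrow> k < n \<Longrightarrow> 0 \<le> G $$ (i, k)"
    and rho: "spectral_radius (map_mat complex_of_real G) < 1"
  shows "\<exists>v. \<forall>i<n. 0 < v i \<and> (\<Sum>k<n. G $$ (i, k) * v k) < v i"
proof -
  let ?C = "map_mat complex_of_real"
  have CG: "?C G \<in> carrier_mat n n" using G by simp
  \<comment> \<open>The midpoint between the spectral radius and 1 lies strictly above the former
    and strictly below the latter.\<close>
  define r where "r = (1 + spectral_radius (?C G)) / 2"
  have r: "0 < r" "r < 1" "spectral_radius (?C G) < r"
    using spectral_radius_nonneg[OF CG n] rho by (auto simp: r_def)
  define R where "R = (1 / r) \<cdot>\<^sub>m G"
  have R: "R \<in> carrier_mat n n" using G by (simp add: R_def)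
  have CR: "?C R = complex_of_real (1 / r) \<cdot>\<^sub>m ?C G"
    unfolding R_def by (rule eq_matI) auto
  have "spectral_radius (?C R) < 1"
    unfolding CR using spectral_radius_smult_less_1[OF CG n r(3)] .
  \<comment> \<open>The Jordan normal form bounds all powers of a matrix with spectral radius below
    one by one constant, entrywise.\<close>
  then obtain c where c: "\<And>k. norm_bound (?C R ^\<^sub>m k) c"
    using spectral_radius_jnf_norm_bound_less_1_upper_triangular[of "?C R" n] R by auto
  have bound: "\<bar>(R ^\<^sub>m k) $$ (i, j)\<bar> \<le> c" if "i < n" "j < n" for i j k
  proof -
    have "?C R ^\<^sub>m k = ?C (R ^\<^sub>m k)"
      by (rule of_real_hom.mat_hom_pow[OF R, symmetric])
    then have "norm (?C (R ^\<^sub>m k) $$ (i, j)) \<le> c"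
      using c[of k] that R by (simp add: norm_bound_def)
    then show ?thesis using that R by simp
  qed
  define e :: "real vec" where "e = vec n (\<lambda>_. 1)"
  have e: "e \<in> carrier_vec n" by (simp add: e_def)
  define u where "u k i = (R ^\<^sub>m k *\<^sub>v e) $ i" for k i
  have u_sum: "u k i = (\<Sum>j<n. (R ^\<^sub>m k) $$ (i, j))" if "i < n" for k i
    unfolding u_def using index_mult_mat_vec_sum[OF pow_carrier_mat[OF R] e that] by (simp add: e_def)
  have u_0: "u 0 i = 1" if "i < n" for i
    unfolding u_def using that R e by (simp add: e_def)
  have u_Suc: "(\<Sum>j<n. G $$ (i, j) * u k j) = r * u (Suc k) i" if "i < n" for k i
  proof -
    have "R ^\<^sub>m Suc k *\<^sub>v e = R *\<^sub>v (R ^\<^sub>m k *\<^sub>v e)"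
      unfolding pow_mat_Suc_left[OF R] using R e by (intro assoc_mult_mat_vec) auto
    then have "u (Suc k) i = (\<Sum>j<n. R $$ (i, j) * u k j)"
      unfolding u_def
      using index_mult_mat_vec_sum[OF R mult_mat_vec_carrier[OF pow_carrier_mat[OF R] e] that] by simp
    also have "\<dots> = (\<Sum>j<n. G $$ (i, j) * u k j) / r"
      using that G by (simp add: R_def sum_divide_distrib)
    finally show ?thesis using r by simp
  qed
  have u_bound: "u k i \<le> of_nat n * c" if "i < n" for k i
    unfolding u_sum[OF that]
    using sum_bounded_above[of "{..<n}" "\<lambda>j. (R ^\<^sub>m k) $$ (i, j)" c] bound that
    by (auto simp: abs_le_iff)
  have u_nonneg: "0 \<le> u k i" if "i < n" for k i
    using that
  proof (induction k arbitrary: i)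
    case (Suc k)
    have "0 \<le> r * u (Suc k) i"
      unfolding u_Suc[OF Suc.prems, symmetric] using Suc nonneg by (intro sum_nonneg) auto
    then show ?case using r by (simp add: zero_le_mult_iff)
  qed (simp add: u_0)
  have "(\<lambda>N. r ^ N * (of_nat n * c)) \<longlonglongrightarrow> 0"
    using r by (intro tendsto_mult_left_zero LIMSEQ_power_zero) auto
  then have "eventually (\<lambda>N. r ^ N * (of_nat n * c) < 1) sequentially"
    by (rule order_tendstoD) simp
  then obtain N where N: "r ^ N * (of_nat n * c) < 1"
    by (auto simp: eventually_sequentially)
  define v where "v i = (\<Sum>k<Suc N. r ^ k * u k i)" for i
  have "0 < v i \<and> (\<Sum>k<n. G $$ (i, k) * v k) < v i" if i: "i < n" for i
  proof
    \<comment> \<open>The term for \<open>k = 0\<close> is 1, which makes \<open>v\<close> positive;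
      the remaining terms are those that multiplication by \<open>G\<close> produces, up to the last
      one.\<close>
    have shift: "v i = 1 + (\<Sum>k<N. r ^ Suc k * u (Suc k) i)"
      unfolding v_def sum.lessThan_Suc_shift using i by (simp add: u_0)
    have "0 \<le> (\<Sum>k<N. r ^ Suc k * u (Suc k) i)"
      using r i u_nonneg by (intro sum_nonneg mult_nonneg_nonneg) auto
    with shift show "0 < v i" by linarith
    have "(\<Sum>k<n. G $$ (i, k) * v k) = (\<Sum>k<Suc N. r ^ k * (\<Sum>j<n. G $$ (i, j) * u k j))"
      unfolding v_def sum_distrib_left by (subst sum.swap) (simp add: mult_ac)
    also have "\<dots> = (\<Sum>k<Suc N. r ^ Suc k * u (Suc k) i)"
      unfolding u_Suc[OF i] by (simp add: mult_ac)
    also have "\<dots> = v i - 1 + r ^ Suc N * u (Suc N) i"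
      using shift by simp
    also have "r ^ Suc N * u (Suc N) i \<le> r ^ Suc N * (of_nat n * c)"
      using r u_bound[OF i] by (intro mult_left_mono) auto
    also have "\<dots> \<le> r ^ N * (of_nat n * c)"
    proof (rule mult_right_mono)
      \<comment> \<open>No sign of \<open>c\<close> is given; the bound on \<open>u 0 i = 1\<close>
        supplies it.\<close>
      show "0 \<le> real n * c"
        using u_bound[OF i, of 0] u_0[OF i] by simp
    qed (use r in \<open>simp add: mult_left_le_one_le\<close>)
    finally show "(\<Sum>k<n. G $$ (i, k) * v k) < v i" using N by linarith
  qed
  then show ?thesis by blast
qed

text \<open>Compare an eigenvector \<open>x\<close> with \<open>v\<close> at the index maximising \<open>\<bar>x\<^sub>i\<bar> / v\<^sub>i\<close>.\<close>

lemma strict_supervector_imp_spectral_radius_less_1: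
  fixes G :: "real mat"
  assumes G: "G \<in> carrier_mat n n" and n: "n > 0"
    and nonneg: "\<And>i k. i < n \<Longrightarrow> k < n \<Longrightarrow> 0 \<le> G $$ (i, k)"
    and v: "\<And>i. i < n \<Longrightarrow> 0 < v i" "\<And>i. i < n \<Longrightarrow> (\<Sum>k<n. G $$ (i, k) * v k) < v i"
  shows "spectral_radius (map_mat complex_of_real G) < 1"
proof -
  let ?A = "map_mat complex_of_real G"
  have A: "?A \<in> carrier_mat n n" using G by simp
  from spectral_radius_mem_max(1)[OF A n] obtain \<mu> x
    where \<mu>: "spectral_radius ?A = norm \<mu>" and ev: "eigenvector ?A x \<mu>"
    by (auto simp: spectrum_def eigenvalue_def)
  have x: "x \<in> carrier_vec n" and x0: "x \<noteq> 0\<^sub>v n" and eq: "?A *\<^sub>v x = \<mu> \<cdot>\<^sub>v x"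
    using ev G by (auto simp: eigenvector_def)
  define q where "q i = norm (x $ i) / v i" for i
  define s where "s = Max (q ` {..<n})"
  have "s \<in> q ` {..<n}" unfolding s_def using n by (intro Max_in) auto
  then obtain i where i: "i < n" and qi: "q i = s" by auto
  have x_le: "norm (x $ k) \<le> s * v k" if "k < n" for k
  proof -
    have "q k \<le> s" unfolding s_def using that by (intro Max_ge) auto
    then show ?thesis using v(1)[OF that] by (simp add: q_def field_simps)
  qed
  have "s > 0"
  proof -
    obtain k where k: "k < n" "x $ k \<noteq> 0"
      using x x0 by (metis carrier_vecD eq_vecI index_zero_vec(1,2))
    then have "0 < norm (x $ k)" by simp
    also have "\<dots> \<le> s * v k" using x_le k by simp
    finally show ?thesis using v(1)[OF k(1)] by (simp add: zero_less_mult_iff)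
  qed
  have xi: "norm (x $ i) = s * v i"
    using qi v(1)[OF i] by (simp add: q_def field_simps)
  have "\<mu> * x $ i = (\<Sum>k<n. of_real (G $$ (i, k)) * x $ k)"
    using arg_cong[OF eq, of "\<lambda>y. y $ i"] index_mult_mat_vec_sum[OF A x i] i x G by simp
  then have "norm \<mu> * norm (x $ i) = norm (\<Sum>k<n. of_real (G $$ (i, k)) * x $ k)"
    by (metis norm_mult)
  also have "\<dots> \<le> (\<Sum>k<n. G $$ (i, k) * (s * v k))"
    by (rule sum_norm_le) (use nonneg i x_le in \<open>auto simp: norm_mult intro!: mult_left_mono\<close>)
  also have "\<dots> = s * (\<Sum>k<n. G $$ (i, k) * v k)"
    by (simp add: sum_distrib_left mult_ac)
  also have "\<dots> < s * v i" using v(2)[OF i] \<open>s > 0\<close> by simp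
  finally have "norm \<mu> * (s * v i) < 1 * (s * v i)" unfolding xi by simp
  then show ?thesis using \<mu> \<open>s > 0\<close> v(1)[OF i] by (simp add: mult_less_cancel_right)
qed

text \<open>Weighted minimum principle: look at the index minimising \<open>y\<^sub>i / v\<^sub>i\<close>.\<close>

lemma supersolution_nonneg:
  fixes K :: "nat \<Rightarrow> nat \<Rightarrow> real"
  assumes K: "\<And>i k. i < n \<Longrightarrow> k < n \<Longrightarrow> 0 \<le> K i k"
    and v: "\<And>i. i < n \<Longrightarrow> 0 < v i" "\<And>i. i < n \<Longrightarrow> (\<Sum>k<n. K i k * v k) < v i"
    and y: "\<And>i. i < n \<Longrightarrow> (\<Sum>k<n. K i k * y k) \<le> y i"
    and j: "j < n"
  shows "0 \<le> y j"
proof (rule ccontr)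
  assume neg: "\<not> 0 \<le> y j"
  define q where "q i = y i / v i" for i
  define s where "s = Min (q ` {..<n})"
  have "s \<in> q ` {..<n}" unfolding s_def using j by (intro Min_in) auto
  then obtain i where i: "i < n" and qi: "q i = s" by auto
  have s_le: "s \<le> q k" if "k < n" for k
    unfolding s_def using that by (intro Min_le) auto
  have "q j < 0" using neg v(1)[OF j] by (simp add: q_def divide_less_0_iff)
  then have "s < 0" using s_le[OF j] by linarith
  have "y i = s * v i" using qi v(1)[OF i] by (simp add: q_def field_simps)
  \<comment> \<open>Since \<open>s < 0\<close>, multiplying the supervector inequality by
    \<open>s\<close> reverses it; the chain then closes to \<open>y i < y i\<close>.\<close>
  also have "\<dots> < s * (\<Sum>k<n. K i k * v k)" using v(2)[OF i] \<open>s < 0\<close> by simp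
  also have "\<dots> = (\<Sum>k<n. K i k * (s * v k))" by (simp add: sum_distrib_left mult_ac)
  also have "\<dots> \<le> (\<Sum>k<n. K i k * y k)"
  proof (intro sum_mono mult_left_mono)
    fix k assume "k \<in> {..<n}"
    then show "s * v k \<le> y k" "0 \<le> K i k"
      using s_le[of k] v(1)[of k] K i by (auto simp: q_def field_simps)
  qed
  also have "\<dots> \<le> y i" using y[OF i] .
  finally show False by simp
qed


section \<open>Bounds on \<open>H\<close> and the linear system solved by the centrality\<close>

lemma G_hat_bounds:
  assumes "network J G" "i < J" "k < J"
  shows "0 \<le> G_hat \<theta> G $$ (i, k)" "G_hat \<theta> G $$ (i, k) \<le> G $$ (i, k)"
  using assms by (auto simp: network_def G_hat_def)

lemma H_mat_index:
  assumes "network J G" "i < J" "k < J"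
  shows "H_mat \<beta> \<theta> w G $$ (i, k) = \<beta> * w i / (\<beta> * w i + 1) * G_hat \<theta> G $$ (i, k)"
  using assms by (auto simp: network_def H_mat_def)

text \<open>Cross-multiplication by the positive denominators reduces the first claim to
  \<open>x \<le> y\<close>. The two quotients are the source term of the centrality and the factor
  scaling a row of \<open>H\<close>, so both react to income in the same direction.\<close>

lemma saturation_mono:
  fixes \<beta> :: real
  assumes "\<beta> > 0" "1 \<le> x" "x \<le> y"
  shows "x / (\<beta> * x + 1) \<le> y / (\<beta> * y + 1)" and "\<beta> * x / (\<beta> * x + 1) \<le> \<beta> * y / (\<beta> * y + 1)"
proof -
  have "0 < \<beta> * x + 1" "0 < \<beta> * y + 1"
    using assms by (auto intro!: add_pos_pos)
  then show *: "x / (\<beta> * x + 1) \<le> y / (\<beta> * y + 1)"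
    using assms by (simp add: divide_simps) (simp add: algebra_simps)
  show "\<beta> * x / (\<beta> * x + 1) \<le> \<beta> * y / (\<beta> * y + 1)"
    using mult_left_mono[OF *, of \<beta>] assms by simp
qed

lemma saturation_strict_mono:
  fixes \<beta> :: real
  assumes "\<beta> > 0" "1 \<le> x" "x < y"
  shows "x / (\<beta> * x + 1) < y / (\<beta> * y + 1)"
proof -
  have "0 < \<beta> * x + 1" "0 < \<beta> * y + 1"
    using assms by (auto intro!: add_pos_pos)
  then show ?thesis
    using assms by (simp add: divide_simps) (simp add: algebra_simps)
qed

lemma saturation_bounds:
  fixes \<beta> :: real
  assumes "\<beta> > 0" "1 \<le> x"
  shows "0 < x / (\<beta> * x + 1)" "0 < \<beta> * x / (\<beta> * x + 1)" "\<beta> * x / (\<beta> * x + 1) \<le> 1"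
proof -
  have "0 < \<beta> * x" using assms by simp
  moreover from this have "0 < \<beta> * x + 1" by linarith
  ultimately show "0 < x / (\<beta> * x + 1)" "0 < \<beta> * x / (\<beta> * x + 1)" "\<beta> * x / (\<beta> * x + 1) \<le> 1"
    using assms by (auto simp: divide_simps)
qed

lemma H_mat_bounds:
  assumes "network J G" "\<beta> > 0" "\<forall>k<J. w k \<ge> 1" "i < J" "k < J"
  shows "0 \<le> H_mat \<beta> \<theta> w G $$ (i, k)" "H_mat \<beta> \<theta> w G $$ (i, k) \<le> G $$ (i, k)"
proof -
  note a = saturation_bounds[OF assms(2) assms(3)[rule_format, OF assms(4)]]
  note g = G_hat_bounds[OF assms(1,4,5), where \<theta> = \<theta>]
  show "0 \<le> H_mat \<beta> \<theta> w G $$ (i, k)"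
    unfolding H_mat_index[OF assms(1,4,5)] using a g by (intro mult_nonneg_nonneg) auto
  have "H_mat \<beta> \<theta> w G $$ (i, k) \<le> 1 * G_hat \<theta> G $$ (i, k)"
    unfolding H_mat_index[OF assms(1,4,5)] using a g by (intro mult_right_mono) auto
  then show "H_mat \<beta> \<theta> w G $$ (i, k) \<le> G $$ (i, k)" using g by simp
qed

text \<open>As \<open>H \<le> G\<close> entrywise and \<open>v > 0\<close>, a strict supervector of
  \<open>G\<close> also serves for \<open>H\<close>.\<close>

lemma H_mat_strict_supervector:
  assumes "network J G" "\<beta> > 0" "\<forall>k<J. w k \<ge> 1" "J > 0"
  shows "\<exists>v. \<forall>i<J. 0 < v i \<and> (\<Sum>k<J. H_mat \<beta> \<theta> w G $$ (i, k) * v k) < v i"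
proof -
  have "\<exists>v. \<forall>i<J. 0 < v i \<and> (\<Sum>k<J. G $$ (i, k) * v k) < v i"
    using assms by (intro spectral_radius_less_1_imp_strict_supervector) (auto simp: network_def)
  then obtain v where v: "\<And>i. i < J \<Longrightarrow> 0 < v i" "\<And>i. i < J \<Longrightarrow> (\<Sum>k<J. G $$ (i, k) * v k) < v i"
    by blast
  have "(\<Sum>k<J. H_mat \<beta> \<theta> w G $$ (i, k) * v k) \<le> (\<Sum>k<J. G $$ (i, k) * v k)" if "i < J" for i
    using H_mat_bounds(2)[OF assms(1-3) that] v(1)
    by (intro sum_mono mult_right_mono) (auto simp: less_imp_le)
  with v show ?thesis by (intro exI[of _ v]) (auto intro: le_less_trans)
qed

lemma H_mat_supersolution_nonneg:
  assumes "network J G" "\<beta> > 0" "\<forall>k<J. w k \<ge> 1"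
    and "\<And>i. i < J \<Longrightarrow> (\<Sum>k<J. H_mat \<beta> \<theta> w G $$ (i, k) * y k) \<le> y i"
    and "j < J"
  shows "0 \<le> y j"
proof -
  have "J > 0" using assms(5) by simp
  then obtain v where v: "\<And>i. i < J \<Longrightarrow> 0 < v i"
    "\<And>i. i < J \<Longrightarrow> (\<Sum>k<J. H_mat \<beta> \<theta> w G $$ (i, k) * v k) < v i"
    using H_mat_strict_supervector[of J G \<beta> w \<theta>] assms(1-3) by blast
  show ?thesis
    by (rule supersolution_nonneg[where K = "\<lambda>i k. H_mat \<beta> \<theta> w G $$ (i, k)", OF _ v])
      (use H_mat_bounds(1)[OF assms(1-3)] assms(4,5) in auto)
qed

text \<open>Multiplying \<open>(I - H)^-1 b\<close> by \<open>I - H\<close> gives the equation, once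
  the inverse is known to exist. All later arguments reach the centrality through this equation
  rather than through the inverse.\<close>

lemma centrality_fixed_point:
  assumes G: "network J G" and \<beta>: "\<beta> > 0" and w: "\<forall>k<J. w k \<ge> 1" and i: "i < J"
  shows "centrality \<beta> \<theta> w G i =
    w i / (\<beta> * w i + 1) + (\<Sum>k<J. H_mat \<beta> \<theta> w G $$ (i, k) * centrality \<beta> \<theta> w G k)"
proof -
  let ?H = "H_mat \<beta> \<theta> w G"
  define M where "M = 1\<^sub>m J - ?H"
  have dim: "dim_row G = J" "dim_col G = J" using G by (auto simp: network_def)
  have H: "?H \<in> carrier_mat J J" by (simp add: H_mat_def dim)
  then have M: "M \<in> carrier_mat J J" unfolding M_def by (intro minus_carrier_mat)
  have M_mult: "(M *\<^sub>v x) $ i = x $ i - (\<Sum>k<J. ?H $$ (i, k) * x $ k)"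
    if "x \<in> carrier_vec J" "i < J" for x i
    using that H by (simp add: M_def minus_mult_distrib_mat_vec[of _ J J] index_mult_mat_vec_sum[OF H]
        del: index_mult_mat_vec)
  have "det M \<noteq> 0"
  proof
    assume "det M = 0"
    then obtain x where x: "x \<in> carrier_vec J" "x \<noteq> 0\<^sub>v J" "M *\<^sub>v x = 0\<^sub>v J"
      using det_0_iff_vec_prod_zero[OF M] by auto
    have eq: "x $ k = (\<Sum>m<J. ?H $$ (k, m) * x $ m)" if "k < J" for k
      using M_mult[OF x(1) that] x(3) that by simp
    have "x $ k = 0" if "k < J" for k
    proof -
      \<comment> \<open>A kernel vector of \<open>I - H\<close> satisfies \<open>x = H x\<close>,
        and so does \<open>- x\<close>; the minimum principle applied to both forces
        \<open>x = 0\<close>.\<close>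
      have "0 \<le> x $ k"
        by (rule H_mat_supersolution_nonneg[OF G \<beta> w _ that, where \<theta> = \<theta> and y = "\<lambda>k. x $ k"]) (simp flip: eq)
      moreover have "0 \<le> - x $ k"
        by (rule H_mat_supersolution_nonneg[OF G \<beta> w _ that, where \<theta> = \<theta> and y = "\<lambda>k. - x $ k"])
          (simp add: sum_negf flip: eq)
      ultimately show ?thesis by simp
    qed
    then show False using x by (metis carrier_vecD eq_vecI index_zero_vec(1,2))
  qed
  \<comment> \<open>The argument \<open>b\<close> only fills the record extension of the matrix
    ring; choosing the same value twice makes both facts speak of one ring.\<close>
  then have "mat_inverse M \<noteq> None"
    using mat_inverse(1)[OF M, where b = "()"] det_non_zero_imp_unit[OF M, where b = "()"] by blast
  then obtain B where B: "mat_inverse M = Some B" "M * B = 1\<^sub>m J" "B \<in> carrier_mat J J"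
    using mat_inverse(2)[OF M] by auto
  define b where "b = vec J (\<lambda>k. w k / (\<beta> * w k + 1))"
  have b: "b \<in> carrier_vec J" by (simp add: b_def)
  have Bb: "B *\<^sub>v b \<in> carrier_vec J" using B b by simp
  have c: "(B *\<^sub>v b) $ k = centrality \<beta> \<theta> w G k" if "k < J" for k
    unfolding centrality_def dim M_def[symmetric] B(1) index_mult_mat_vec_sum[OF B(3) b that]
    by (simp add: b_def)
  have "M *\<^sub>v (B *\<^sub>v b) = b"
    using assoc_mult_mat_vec[OF M B(3) b] B(2) b by simp
  then have "b $ i = (B *\<^sub>v b) $ i - (\<Sum>k<J. ?H $$ (i, k) * (B *\<^sub>v b) $ k)"
    using M_mult[OF Bb i] by simp
  then show ?thesis using i c by (simp add: b_def)
qed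

text \<open>The source term is positive, so the centrality is a supersolution and hence nonnegative;
  inserting this into the fixed-point equation leaves at least the source term.\<close>

lemma centrality_pos:
  assumes G: "network J G" and \<beta>: "\<beta> > 0" and w: "\<forall>k<J. w k \<ge> 1" and i: "i < J"
  shows "0 < centrality \<beta> \<theta> w G i"
proof -
  have nonneg: "0 \<le> centrality \<beta> \<theta> w G k" if "k < J" for k
    using that
  proof (rule H_mat_supersolution_nonneg[OF G \<beta> w, rotated -1])
    fix m assume m: "m < J"
    show "(\<Sum>k<J. H_mat \<beta> \<theta> w G $$ (m, k) * centrality \<beta> \<theta> w G k) \<le> centrality \<beta> \<theta> w G m"
      using centrality_fixed_point[OF G \<beta> w m, where \<theta> = \<theta>] saturation_bounds(1)[OF \<beta> w[rule_format, OF m]] by simp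
  qed
  have "0 \<le> (\<Sum>k<J. H_mat \<beta> \<theta> w G $$ (i, k) * centrality \<beta> \<theta> w G k)"
    using nonneg H_mat_bounds(1)[OF G \<beta> w i] by (intro sum_nonneg mult_nonneg_nonneg) auto
  then show ?thesis
    using centrality_fixed_point[OF G \<beta> w i, where \<theta> = \<theta>] saturation_bounds(1)[OF \<beta> w[rule_format, OF i]] by simp
qed

section \<open>Walks, and the effect of changing one row of the data\<close>

lemma walk_exists_refl:
  assumes "i < dim_row G"
  shows "walk_exists \<theta> G i i"
  using assms unfolding walk_exists_def is_walk_def by (intro exI[of _ "[i]"]) auto

lemma walk_exists_step:
  assumes "G_hat \<theta> G $$ (i, k) > 0" "i < dim_row G" "walk_exists \<theta> G k l"
  shows "walk_exists \<theta> G i l"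
proof -
  obtain p where "is_walk \<theta> G k l p" using assms by (auto simp: walk_exists_def)
  then have "is_walk \<theta> G i l (i # p)"
    using assms by (auto simp: is_walk_def successively_Cons)
  then show ?thesis by (auto simp: walk_exists_def)
qed

text \<open>The endpoint \<open>l\<close> is fixed and the starting point varies, so the induction
  moves backwards along edges from \<open>l\<close>. This is the direction in which positivity
  spreads through \<open>y = r + H' y\<close>.\<close>

lemma walk_exists_induct [consumes 1, case_names refl step]:
  assumes "walk_exists \<theta> G i l"
    and "l < dim_row G \<Longrightarrow> P l"
    and "\<And>i k. i < dim_row G \<Longrightarrow> k < dim_row G \<Longrightarrow> G_hat \<theta> G $$ (i, k) > 0 \<Longrightarrow> P k \<Longrightarrow> P i"
  shows "P i"
proof -
  obtain p where "is_walk \<theta> G i l p" using assms(1) by (auto simp: walk_exists_def)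
  then show ?thesis
  proof (induction p arbitrary: i)
    case Nil
    then show ?case by (simp add: is_walk_def)
  next
    case (Cons a p)
    show ?case
    proof (cases "p = []")
      case True
      then show ?thesis using Cons.prems assms(2) by (auto simp: is_walk_def)
    next
      case False
      then have "is_walk \<theta> G (hd p) l p" "G_hat \<theta> G $$ (i, hd p) > 0" "i < dim_row G" "hd p < dim_row G"
        using Cons.prems by (cases p; auto simp: is_walk_def)+
      then show ?thesis using Cons.IH assms(3) by blast
    qed
  qed
qed

text \<open>Every edge of \<open>G_hat\<close> joins agents of equal identity. This yields the
  clause \<open>\<theta> j = \<theta> l\<close> of the final equivalences.\<close>

lemma walk_exists_same_identity:
  fixes \<theta> :: "nat \<Rightarrow> identity"
  assumes "walk_exists \<theta> G i l" "dim_col G = dim_row G"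
  shows "\<theta> i = \<theta> l"
  using assms(1)
proof (induction rule: walk_exists_induct)
  case (step i k)
  then show ?case using assms(2) by (auto simp: G_hat_def split: if_splits)
qed simp

text \<open>The walks are those of a reference network \<open>G\<^sub>0\<close> that may differ from \<open>G\<close> and \<open>G'\<close> in
  row \<open>l\<close>: whether \<open>l\<close> can be reached does not depend on the edges out of \<open>l\<close>.\<close>

lemma centrality_change_row:
  fixes \<theta> :: "nat \<Rightarrow> identity"
  assumes G: "network J G" and G': "network J G'" and G0: "network J G0" and \<beta>: "\<beta> > 0"
    and w: "\<forall>k<J. w k \<ge> 1" and w': "\<forall>k<J. w' k \<ge> 1"
    and j: "j < J" and l: "l < J"
    and row: "\<forall>i<J. \<forall>k<J. i \<noteq> l \<longrightarrow> G $$ (i, k) = G0 $$ (i, k) \<and> G' $$ (i, k) = G0 $$ (i, k)"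
    and inc: "\<forall>i<J. i \<noteq> l \<longrightarrow> w' i = w i"
  defines "r \<equiv> w' l / (\<beta> * w' l + 1) - w l / (\<beta> * w l + 1)
      + (\<Sum>k<J. (H_mat \<beta> \<theta> w' G' $$ (l, k) - H_mat \<beta> \<theta> w G $$ (l, k)) * centrality \<beta> \<theta> w G k)"
  shows "0 \<le> r \<Longrightarrow> centrality \<beta> \<theta> w G j \<le> centrality \<beta> \<theta> w' G' j"
    and "0 < r \<Longrightarrow> walk_exists \<theta> G0 j l \<Longrightarrow> centrality \<beta> \<theta> w G j < centrality \<beta> \<theta> w' G' j"
    and "\<not> walk_exists \<theta> G0 j l \<Longrightarrow> centrality \<beta> \<theta> w G j = centrality \<beta> \<theta> w' G' j"
proof -
  let ?H = "\<lambda>i k. H_mat \<beta> \<theta> w G $$ (i, k)" and ?H' = "\<lambda>i k. H_mat \<beta> \<theta> w' G' $$ (i, k)"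
  let ?c = "centrality \<beta> \<theta> w G" and ?c' = "centrality \<beta> \<theta> w' G'"
  define y where "y i = ?c' i - ?c i" for i
  have dim: "dim_row G = J" "dim_col G = J" "dim_row G' = J" "dim_col G' = J"
    "dim_row G0 = J" "dim_col G0 = J"
    using G G' G0 by (auto simp: network_def)
  have H': "0 \<le> ?H' i k" if "i < J" "k < J" for i k
    using H_mat_bounds(1)[OF G' \<beta> w' that] .
  have G_hat_row: "G_hat \<theta> G $$ (i, k) = G_hat \<theta> G0 $$ (i, k)" "G_hat \<theta> G' $$ (i, k) = G_hat \<theta> G0 $$ (i, k)"
    if "i < J" "k < J" "i \<noteq> l" for i k
    using row[rule_format, OF that] that by (auto simp: G_hat_def dim)
  have H'_row: "?H' i k = ?H i k" if "i < J" "k < J" "i \<noteq> l" for i k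
    using that by (simp add: H_mat_index[OF G] H_mat_index[OF G'] G_hat_row inc)
  \<comment> \<open>Subtract the two fixed-point equations and split \<open>H' c' - H c\<close> as
    \<open>(H' - H) c + H' (c' - c)\<close>: the data change meets the old centrality, and the
    difference is propagated by the new matrix.\<close>
  have y: "y i = (w' i / (\<beta> * w' i + 1) - w i / (\<beta> * w i + 1)
      + (\<Sum>k<J. (?H' i k - ?H i k) * ?c k)) + (\<Sum>k<J. ?H' i k * y k)" if "i < J" for i
    unfolding y_def using centrality_fixed_point[OF G \<beta> w that, where \<theta> = \<theta>] centrality_fixed_point[OF G' \<beta> w' that, where \<theta> = \<theta>]
    by (simp add: algebra_simps sum.distrib sum_subtractf)
  have y_l: "y l = r + (\<Sum>k<J. ?H' l k * y k)"
    using y[OF l] by (simp add: r_def)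
  have y_row: "y i = (\<Sum>k<J. ?H' i k * y k)" if "i < J" "i \<noteq> l" for i
  proof -
    have "(\<Sum>k<J. (?H' i k - ?H i k) * ?c k) = 0"
      using that by (intro sum.neutral) (simp add: H'_row)
    then show ?thesis using y[OF that(1)] inc[rule_format, OF that] by simp
  qed
  have y_nonneg: "0 \<le> y i" if "0 \<le> r" "i < J" for i
  proof (rule H_mat_supersolution_nonneg[OF G' \<beta> w' _ that(2)])
    fix i assume "i < J"
    then show "(\<Sum>k<J. H_mat \<beta> \<theta> w' G' $$ (i, k) * y k) \<le> y i"
      using y_l y_row[of i] that(1) by (cases "i = l") auto
  qed
  then show "0 \<le> r \<Longrightarrow> ?c j \<le> ?c' j" using j by (force simp: y_def)
  show "?c j < ?c' j" if r: "0 < r" and "walk_exists \<theta> G0 j l"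
  proof -
    have sum_nonneg': "0 \<le> ?H' i k * y k" if "i < J" "k < J" for i k
      using H' y_nonneg r that by (intro mult_nonneg_nonneg) auto
    have l_pos: "0 < y l"
      using y_l r sum_nonneg[of "{..<J}" "\<lambda>k. ?H' l k * y k"] sum_nonneg' l by force
    have "0 < y j"
      using that(2)
    proof (induction rule: walk_exists_induct)
      case refl
      then show ?case using l_pos by simp
    next
      case (step i k)
      then have ik: "i < J" "k < J" by (auto simp: dim)
      show ?case
      proof (cases "i = l")
        case False
        have "0 < ?H' i k"
          unfolding H_mat_index[OF G' ik] G_hat_row[OF ik False]
          using saturation_bounds(2)[OF \<beta> w'[rule_format, OF ik(1)]] step by (intro mult_pos_pos)
        then have "0 < ?H' i k * y k" using step by simp
        also have "\<dots> \<le> y i"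
          unfolding y_row[OF ik(1) False] using ik sum_nonneg' by (intro member_le_sum) auto
        finally show ?thesis .
      qed (use l_pos in simp)
    qed
    then show ?thesis by (simp add: y_def)
  qed
  show "?c j = ?c' j" if no_walk: "\<not> walk_exists \<theta> G0 j l"
  proof -
    \<comment> \<open>Restriction to the agents that cannot reach \<open>l\<close>: rows of the
      other agents are zeroed, which keeps \<open>K v < v\<close> because \<open>v > 0\<close>. Then
      \<open>z = K z\<close>, and the minimum principle for \<open>z\<close> and \<open>- z\<close>
      gives \<open>z = 0\<close>.\<close>
    define K where "K i k = (if walk_exists \<theta> G0 i l then 0 else ?H' i k)" for i k
    define z where "z i = (if walk_exists \<theta> G0 i l then 0 else y i)" for i
    have z: "z i = (\<Sum>k<J. K i k * z k)" if i: "i < J" for i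
    proof (cases "walk_exists \<theta> G0 i l")
      case False
      \<comment> \<open>The one-element walk shows that \<open>l\<close> reaches itself.\<close>
      then have "i \<noteq> l" using walk_exists_refl[of l G0 \<theta>] l by (auto simp: dim)
      have "?H' i k * y k = K i k * z k" if k: "k < J" for k
      proof (cases "walk_exists \<theta> G0 k l")
        case True
        \<comment> \<open>An edge from \<open>i\<close> to an agent that reaches \<open>l\<close>
          would let \<open>i\<close> reach \<open>l\<close> as well.\<close>
        then have "\<not> 0 < G_hat \<theta> G0 $$ (i, k)"
          using False walk_exists_step[of \<theta> G0 i k l] i by (auto simp: dim)
        then have "G_hat \<theta> G0 $$ (i, k) = 0" using G_hat_bounds(1)[OF G0 i k, where \<theta> = \<theta>] by simp
        then have "?H' i k = 0"
          unfolding H_mat_index[OF G' i k] G_hat_row[OF i k \<open>i \<noteq> l\<close>] by simp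
        then show ?thesis using True by (simp add: z_def)
      qed (use False in \<open>simp add: K_def z_def\<close>)
      then show ?thesis using False y_row[OF i \<open>i \<noteq> l\<close>] by (simp add: z_def)
    qed (simp add: z_def K_def)
    have "J > 0" using j by simp
    then obtain v where v: "\<And>i. i < J \<Longrightarrow> 0 < v i" "\<And>i. i < J \<Longrightarrow> (\<Sum>k<J. ?H' i k * v k) < v i"
      using H_mat_strict_supervector[of J G' \<beta> w' \<theta>] G' \<beta> w' by blast
    have Kv: "(\<Sum>k<J. K i k * v k) < v i" if "i < J" for i
      using v[OF that] by (cases "walk_exists \<theta> G0 i l") (simp_all add: K_def)
    have K: "0 \<le> K i k" if "i < J" "k < J" for i k
      using H'[OF that] by (simp add: K_def)
    have "0 \<le> z j"
      by (rule supersolution_nonneg[where K = K and y = z, OF K v(1) Kv _ j]) (simp_all flip: z)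
    moreover have "0 \<le> - z j"
      by (rule supersolution_nonneg[where K = K and y = "\<lambda>i. - z i", OF K v(1) Kv _ j])
        (simp_all add: sum_negf flip: z)
    ultimately show ?thesis using no_walk by (simp add: z_def y_def)
  qed
qed


section \<open>A criterion for strictness, and monotonicity in income\<close>

text \<open>Constancy contradicts strict monotonicity only if the domain has two distinct points,
  which is why \<open>a < b\<close> are asked for.\<close>

lemma strict_mono_on_iff_condition:
  fixes f :: "real \<Rightarrow> real"
  assumes two: "a \<in> S" "b \<in> S" "a < b"
    and strict: "\<And>x y. P \<Longrightarrow> x \<in> S \<Longrightarrow> y \<in> S \<Longrightarrow> x < y \<Longrightarrow> f x < f y"
    and const: "\<And>x y. \<not> P \<Longrightarrow> x \<in> S \<Longrightarrow> y \<in> S \<Longrightarrow> x < y \<Longrightarrow> f x = f y"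
  shows "strict_mono_on S f \<longleftrightarrow> P"
proof
  assume "strict_mono_on S f"
  then have "f a < f b" using two by (auto simp: strict_mono_on_def)
  then show P using const[OF _ two] by auto
qed (use strict in \<open>auto simp: strict_mono_on_def\<close>)

text \<open>A higher \<open>w l\<close> raises the source term at \<open>l\<close> strictly and row
  \<open>l\<close> of \<open>H\<close> weakly. Centralities are positive, so the residual at
  \<open>l\<close> is at least the gain in the source term.\<close>

lemma centrality_income_monotonicity:
  fixes \<theta> :: "nat \<Rightarrow> identity" and w :: "nat \<Rightarrow> real"
  assumes G: "network J G" and \<beta>: "\<beta> > 0" and w: "\<forall>k<J. w k \<ge> 1"
    and j: "j < J" and l: "l < J"
  shows "mono_on {1..} (\<lambda>x. centrality \<beta> \<theta> (w(l := x)) G j)"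
    and "strict_mono_on {1..} (\<lambda>x. centrality \<beta> \<theta> (w(l := x)) G j) \<longleftrightarrow> walk_exists \<theta> G j l"
proof -
  let ?c = "\<lambda>x. centrality \<beta> \<theta> (w(l := x)) G"
  have wx: "\<forall>k<J. (w(l := x)) k \<ge> 1" if "1 \<le> x" for x using w that by simp
  define r where "r x x' = (w(l := x')) l / (\<beta> * (w(l := x')) l + 1) - (w(l := x)) l / (\<beta> * (w(l := x)) l + 1)
      + (\<Sum>k<J. (H_mat \<beta> \<theta> (w(l := x')) G $$ (l, k) - H_mat \<beta> \<theta> (w(l := x)) G $$ (l, k)) * ?c x k)" for x x'
  have r_ge: "x' / (\<beta> * x' + 1) - x / (\<beta> * x + 1) \<le> r x x'" if "1 \<le> x" "x \<le> x'" for x x'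
  proof -
    have "0 \<le> (\<Sum>k<J. (H_mat \<beta> \<theta> (w(l := x')) G $$ (l, k) - H_mat \<beta> \<theta> (w(l := x)) G $$ (l, k)) * ?c x k)"
    proof (intro sum_nonneg mult_nonneg_nonneg)
      fix k assume "k \<in> {..<J}"
      then have k: "k < J" by simp
      show "0 \<le> ?c x k" using centrality_pos[OF G \<beta> wx[OF that(1)] k, where \<theta> = \<theta>] by (rule less_imp_le)
      have "\<beta> * x / (\<beta> * x + 1) * G_hat \<theta> G $$ (l, k) \<le> \<beta> * x' / (\<beta> * x' + 1) * G_hat \<theta> G $$ (l, k)"
        using saturation_mono(2)[OF \<beta> that] G_hat_bounds(1)[OF G l k] by (rule mult_right_mono)
      then show "0 \<le> H_mat \<beta> \<theta> (w(l := x')) G $$ (l, k) - H_mat \<beta> \<theta> (w(l := x)) G $$ (l, k)"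
        by (simp add: H_mat_index[OF G l k])
    qed
    then show ?thesis by (simp add: r_def)
  qed
  have row: "\<forall>i<J. \<forall>k<J. i \<noteq> l \<longrightarrow> G $$ (i, k) = G $$ (i, k) \<and> G $$ (i, k) = G $$ (i, k)"
    and inc: "\<forall>i<J. i \<noteq> l \<longrightarrow> (w(l := x')) i = (w(l := x)) i" for x x'
    by simp_all
  have change: "0 \<le> r x x' \<Longrightarrow> ?c x j \<le> ?c x' j"
    "0 < r x x' \<Longrightarrow> walk_exists \<theta> G j l \<Longrightarrow> ?c x j < ?c x' j"
    "\<not> walk_exists \<theta> G j l \<Longrightarrow> ?c x j = ?c x' j" if "1 \<le> x" "1 \<le> x'" for x x'
    unfolding r_def
    by (fact centrality_change_row[OF G G G \<beta> wx[OF that(1)] wx[OF that(2)] j l row inc])+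
  show "mono_on {1..} (\<lambda>x. ?c x j)"
  proof (rule mono_onI)
    fix x x' :: real assume "x \<in> {1..}" "x' \<in> {1..}" and le: "x \<le> x'"
    then have x: "1 \<le> x" "1 \<le> x'" by auto
    have "0 \<le> r x x'"
      using r_ge[OF x(1) le] saturation_mono(1)[OF \<beta> x(1) le] by linarith
    then show "?c x j \<le> ?c x' j" by (rule change(1)[OF x])
  qed
  show "strict_mono_on {1..} (\<lambda>x. ?c x j) \<longleftrightarrow> walk_exists \<theta> G j l"
  proof (rule strict_mono_on_iff_condition[where a = 1 and b = 2])
    fix x x' :: real assume "x \<in> {1..}" "x' \<in> {1..}" and less: "x < x'"
    then have x: "1 \<le> x" "1 \<le> x'" by auto
    have "0 < r x x'"
      using r_ge[OF x(1) less_imp_le[OF less]] saturation_strict_mono[OF \<beta> x(1) less] by linarith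
    then show "walk_exists \<theta> G j l \<Longrightarrow> ?c x j < ?c x' j"
      using change(2)[OF x] by blast
    show "\<not> walk_exists \<theta> G j l \<Longrightarrow> ?c x j = ?c x' j"
      by (rule change(3)[OF x])
  qed auto
qed

section \<open>Monotonicity in a link weight\<close>

lemma network_update_mat_index:
  assumes "network J G" "l < J" "m < J" "i < J" "k < J"
  shows "(G |\<^sub>m (l, m) \<mapsto> t) $$ (i, k) = (if i = l \<and> k = m then t else G $$ (i, k))"
  using assms by (auto simp: network_def update_mat_def)

text \<open>A small increase uses up only part of the slack of a strict supervector \<open>v\<close>
  in row \<open>l\<close>, so \<open>v\<close> remains one and the spectral radius stays below one.
  The diagonal stays zero because \<open>l \<noteq> m\<close>.\<close>

lemma network_increase_entry:
  assumes G: "network J G" and l: "l < J" and m: "m < J" and lm: "l \<noteq> m"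
  shows "\<exists>t > G $$ (l, m). network J (G |\<^sub>m (l, m) \<mapsto> t)"
proof -
  have J: "J > 0" using l by simp
  have carrier: "G \<in> carrier_mat J J" and nonneg: "\<And>i k. i < J \<Longrightarrow> k < J \<Longrightarrow> 0 \<le> G $$ (i, k)"
    using G by (auto simp: network_def)
  have "\<exists>v. \<forall>i<J. 0 < v i \<and> (\<Sum>k<J. G $$ (i, k) * v k) < v i"
    using G J by (intro spectral_radius_less_1_imp_strict_supervector) (auto simp: network_def)
  then obtain v where v: "\<And>i. i < J \<Longrightarrow> 0 < v i" "\<And>i. i < J \<Longrightarrow> (\<Sum>k<J. G $$ (i, k) * v k) < v i"
    by blast
  \<comment> \<open>Chosen so that \<open>e * v m\<close> is half the slack in row
    \<open>l\<close>.\<close>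
  define e where "e = (v l - (\<Sum>k<J. G $$ (l, k) * v k)) / (2 * v m)"
  have e: "0 < e" unfolding e_def using v l m by simp
  have ev: "(\<Sum>k<J. G $$ (l, k) * v k) + e * v m < v l"
  proof -
    have "e * v m = (v l - (\<Sum>k<J. G $$ (l, k) * v k)) / 2"
      using v(1)[OF m] by (simp add: e_def)
    moreover have "s + (v l - s) / 2 < v l" if "s < v l" for s
      using that by (simp add: field_simps)
    from this[OF v(2)[OF l]]
    have "(\<Sum>k<J. G $$ (l, k) * v k) + (v l - (\<Sum>k<J. G $$ (l, k) * v k)) / 2 < v l" .
    ultimately show ?thesis by (simp only:)
  qed
  let ?G' = "G |\<^sub>m (l, m) \<mapsto> (G $$ (l, m) + e)"
  note idx = network_update_mat_index[OF G l m]
  have carrier': "?G' \<in> carrier_mat J J" by (intro carrier_matI) (simp_all only: dim_update_mat carrier_matD[OF carrier])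
  have nonneg': "0 \<le> ?G' $$ (i, k)" if "i < J" "k < J" for i k
    using nonneg[OF that] nonneg[OF l m] e by (simp add: idx[OF that])
  have less: "(\<Sum>k<J. ?G' $$ (i, k) * v k) < v i" if i: "i < J" for i
  proof -
    have "(\<Sum>k<J. ?G' $$ (i, k) * v k) = (\<Sum>k<J. G $$ (i, k) * v k + (if k = m then if i = l then e * v m else 0 else 0))"
      using i by (intro sum.cong) (simp_all add: idx distrib_right)
    also have "\<dots> = (\<Sum>k<J. G $$ (i, k) * v k) + (if i = l then e * v m else 0)"
      using m by (simp add: sum.distrib)
    also have "\<dots> < v i" using v(2)[OF i] ev by simp
    finally show ?thesis .
  qed
  have "spectral_radius (map_mat complex_of_real ?G') < 1"
    by (rule strict_supervector_imp_spectral_radius_less_1[OF carrier' J, where v = v])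
      (rule nonneg' v(1) less; assumption)+
  moreover have "?G' $$ (i, i) = 0" if "i < J" for i
    using that G lm by (simp add: idx network_def)
  ultimately have "network J ?G'"
    unfolding network_def using carrier' nonneg' by blast
  moreover have "G $$ (l, m) + e > G $$ (l, m)" using e by simp
  ultimately show ?thesis by blast
qed

lemma network_update_mat_self:
  assumes "network J G" "l < J" "m < J"
  shows "G |\<^sub>m (l, m) \<mapsto> (G $$ (l, m)) = G"
  using assms by (intro eq_matI) (auto simp: update_mat_def)

text \<open>Only entry \<open>(l, m)\<close> of \<open>H\<close> can change, and only when
  \<open>\<theta> l = \<theta> m\<close>; the residual at \<open>l\<close> is then a positive
  multiple of \<open>t' - t\<close>, since the centrality of \<open>m\<close> is positive.\<close>

lemma centrality_link_monotonicity:
  fixes \<theta> :: "nat \<Rightarrow> identity" and w :: "nat \<Rightarrow> real"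
  assumes G: "network J G" and \<beta>: "\<beta> > 0" and w: "\<forall>k<J. w k \<ge> 1"
    and j: "j < J" and l: "l < J" and m: "m < J"
  defines "S \<equiv> {t. network J (G |\<^sub>m (l, m) \<mapsto> t)}"
  shows "mono_on S (\<lambda>t. centrality \<beta> \<theta> w (G |\<^sub>m (l, m) \<mapsto> t) j)"
    and "l \<noteq> m \<Longrightarrow> strict_mono_on S (\<lambda>t. centrality \<beta> \<theta> w (G |\<^sub>m (l, m) \<mapsto> t) j)
      \<longleftrightarrow> \<theta> l = \<theta> m \<and> walk_exists \<theta> G j l"
proof -
  let ?G = "\<lambda>t. G |\<^sub>m (l, m) \<mapsto> t"
  let ?c = "\<lambda>t. centrality \<beta> \<theta> w (?G t)"
  have S: "network J (?G t)" if "t \<in> S" for t using that by (simp add: S_def)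
  note idx = network_update_mat_index[OF G l m]
  define r where "r t t' = (\<Sum>k<J. (H_mat \<beta> \<theta> w (?G t') $$ (l, k) - H_mat \<beta> \<theta> w (?G t) $$ (l, k)) * ?c t k)" for t t'
  have dim: "dim_row G = J" "dim_col G = J" using G by (auto simp: network_def)
  have G_hat_diff: "G_hat \<theta> (?G t') $$ (l, k) - G_hat \<theta> (?G t) $$ (l, k)
      = (if k = m then if \<theta> l = \<theta> m then t' - t else 0 else 0)" if "k < J" for k t t'
    using that l dim by (simp add: G_hat_def idx)
  define a where "a = \<beta> * w l / (\<beta> * w l + 1)"
  have a: "0 < a" unfolding a_def using saturation_bounds(2)[OF \<beta> w[rule_format, OF l]] .
  have r: "r t t' = (if \<theta> l = \<theta> m then a * (t' - t) * ?c t m else 0)" if t: "t \<in> S" "t' \<in> S" for t t'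
  proof -
    have "r t t' = (\<Sum>k<J. if k = m then if \<theta> l = \<theta> m then a * (t' - t) * ?c t m else 0 else 0)"
      unfolding r_def
    proof (rule sum.cong)
      fix k assume "k \<in> {..<J}"
      then have k: "k < J" by simp
      have "H_mat \<beta> \<theta> w (?G t') $$ (l, k) - H_mat \<beta> \<theta> w (?G t) $$ (l, k)
          = a * (G_hat \<theta> (?G t') $$ (l, k) - G_hat \<theta> (?G t) $$ (l, k))"
        unfolding H_mat_index[OF S[OF t(1)] l k] H_mat_index[OF S[OF t(2)] l k] a_def right_diff_distrib ..
      then have "H_mat \<beta> \<theta> w (?G t') $$ (l, k) - H_mat \<beta> \<theta> w (?G t) $$ (l, k)
          = (if k = m then if \<theta> l = \<theta> m then a * (t' - t) else 0 else 0)"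
        unfolding G_hat_diff[OF k] by (simp only: if_distrib[of "(*) a"] mult_zero_right)
      then show "(H_mat \<beta> \<theta> w (?G t') $$ (l, k) - H_mat \<beta> \<theta> w (?G t) $$ (l, k)) * ?c t k
          = (if k = m then if \<theta> l = \<theta> m then a * (t' - t) * ?c t m else 0 else 0)"
        by (simp only: split: if_split) simp
    qed simp
    then show ?thesis using m by simp
  qed
  \<comment> \<open>The original \<open>G\<close> is the reference network for walks: all admissible
    updates agree with it off row \<open>l\<close>, so one walk condition serves for every
    weight.\<close>
  have row: "\<forall>i<J. \<forall>k<J. i \<noteq> l \<longrightarrow> ?G t $$ (i, k) = G $$ (i, k) \<and> ?G t' $$ (i, k) = G $$ (i, k)" for t t'
    by (simp add: idx)
  have inc: "\<forall>i<J. i \<noteq> l \<longrightarrow> w i = w i" by simp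
  have change: "0 \<le> r t t' \<Longrightarrow> ?c t j \<le> ?c t' j"
    "0 < r t t' \<Longrightarrow> walk_exists \<theta> G j l \<Longrightarrow> ?c t j < ?c t' j"
    "\<not> walk_exists \<theta> G j l \<Longrightarrow> ?c t j = ?c t' j" if "t \<in> S" "t' \<in> S" for t t'
    unfolding r_def
    by (fact centrality_change_row[OF S[OF that(1)] S[OF that(2)] G \<beta> w w j l row inc,
          unfolded diff_self add_0])+
  show "mono_on S (\<lambda>t. ?c t j)"
  proof (rule mono_onI)
    fix t t' assume t: "t \<in> S" "t' \<in> S" "t \<le> t'"
    then have "0 \<le> r t t'"
      using a centrality_pos[OF S \<beta> w m, of t, where \<theta> = \<theta>] by (simp add: r)
    then show "?c t j \<le> ?c t' j" by (rule change(1)[OF t(1,2)])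
  qed
  show "strict_mono_on S (\<lambda>t. ?c t j) \<longleftrightarrow> \<theta> l = \<theta> m \<and> walk_exists \<theta> G j l" if lm: "l \<noteq> m"
  proof -
    obtain t1 where t1: "t1 > G $$ (l, m)" "t1 \<in> S"
      using network_increase_entry[OF G l m lm] by (auto simp: S_def)
    have t0: "G $$ (l, m) \<in> S" using G by (simp add: S_def network_update_mat_self[OF G l m])
    show ?thesis
    proof (rule strict_mono_on_iff_condition[OF t0 t1(2,1)])
      fix t t' assume t: "t \<in> S" "t' \<in> S" "t < t'"
      show "?c t j < ?c t' j" if "\<theta> l = \<theta> m \<and> walk_exists \<theta> G j l"
      proof -
        have "0 < r t t'" using that t a centrality_pos[OF S \<beta> w m, of t, where \<theta> = \<theta>] by (simp add: r)
        then show ?thesis by (rule change(2)[OF t(1,2)]) (use that in blast)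
      qed
      show "?c t j = ?c t' j" if "\<not> (\<theta> l = \<theta> m \<and> walk_exists \<theta> G j l)"
      proof (cases "walk_exists \<theta> G j l")
        case True
        then have "\<theta> l \<noteq> \<theta> m" using that by blast
        \<comment> \<open>A zero residual in both directions gives both weak inequalities, hence
          equality even though \<open>j\<close> reaches \<open>l\<close>.\<close>
        then have "r t t' = 0" "r t' t = 0" using r t by simp_all
        then show ?thesis
          using change(1)[OF t(1,2)] change(1)[OF t(2,1)] by (intro antisym) simp_all
      qed (rule change(3)[OF t(1,2)])
    qed
  qed
qed

text \<open>The walk runs from \<open>j\<close> to \<open>l\<close>, since \<open>C_j\<close> feels
  row \<open>l\<close> through the entries \<open>(j, l)\<close> of the powers of \<open>H\<close>.
  In the link part, \<open>\<theta> l = \<theta> m\<close> enters because \<open>G_hat\<close> drops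
  links across identities. The case \<open>l = m\<close> is set apart because the zero diagonal
  admits only the weight 0, and on a single point strict monotonicity is vacuous.\<close>

theorem mainTheorem3:
  fixes J :: nat and \<beta> :: real and \<theta> :: "nat \<Rightarrow> identity"
    and w :: "nat \<Rightarrow> real" and G :: "real mat" and j l m :: nat
  assumes "network J G"
    and "\<beta> > 0"
    and "\<And>k. k < J \<Longrightarrow> w k \<ge> 1"
    and "j < J" and "l < J" and "m < J"
  shows
    "mono_on {1..} (\<lambda>x. centrality \<beta> \<theta> (w(l := x)) G j)
     \<and> (strict_mono_on {1..} (\<lambda>x. centrality \<beta> \<theta> (w(l := x)) G j)
          \<longleftrightarrow> \<theta> j = \<theta> l \<and> walk_exists \<theta> G j l)
     \<and> mono_on {t. network J (update_mat G (l, m) t)}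
          (\<lambda>t. centrality \<beta> \<theta> w (update_mat G (l, m) t) j)
     \<and> (l \<noteq> m \<longrightarrow>
          (strict_mono_on {t. network J (update_mat G (l, m) t)}
             (\<lambda>t. centrality \<beta> \<theta> w (update_mat G (l, m) t) j)
           \<longleftrightarrow> \<theta> j = \<theta> l \<and> \<theta> l = \<theta> m \<and> walk_exists \<theta> G j l))"
proof -
  have "\<theta> j = \<theta> l" if "walk_exists \<theta> G j l"
    using walk_exists_same_identity[OF that] assms(1) by (auto simp: network_def)
  moreover have "\<forall>k<J. w k \<ge> 1" using assms(3) by blast
  ultimately show ?thesis
    using centrality_income_monotonicity[OF assms(1,2) _ assms(4,5), of w \<theta>]
      centrality_link_monotonicity[OF assms(1,2) _ assms(4-6), of w \<theta>] by blast
qed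

end
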